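(* Let $\Psi:\mathbb{S}^1\to\mathbb{R}^{+}$ be a smooth even function. If the $L_{-2}$ Minkowski problem with data $\Psi$ has a solution, i.e. if there exists a smooth positive function $s$ on $\mathbb{S}^1$ with $$s\,(s_{\theta\theta}+s)^{1/3}=\Psi ,$$ then $\Psi$ must have $8$ or more critical points on $[0,2\pi]$ (identified with the unit circle).
   Context: Functions on $\mathbb{S}^1$ are identified with $2\pi$-periodic functions of the angle $\theta$. A function $\Psi$ on $\mathbb{S}^1$ is even if $\Psi(\theta+\pi)=\Psi(\theta)$ for all $\theta$. A critical point of $\Psi$ is a point where $\Psi_\theta=0$. *)

theory Defs
  imports "HOL-Analysis.Analysis"
begin

text \<open>Functions on the unit circle are represented by \<open>2 * pi\<close>-periodic functions of the angle.\<close>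

definition smooth_on_circle :: "(real \<Rightarrow> real) \<Rightarrow> bool" where
  "smooth_on_circle f \<longleftrightarrow>
     (\<forall>t. f (t + 2 * pi) = f t) \<and> (\<forall>n t. (deriv ^^ n) f differentiable (at t))"

definition even_on_circle :: "(real \<Rightarrow> real) \<Rightarrow> bool" where
  "even_on_circle f \<longleftrightarrow> (\<forall>t. f (t + pi) = f t)"

text \<open>The cube root is \<open>root 3\<close>, the odd real cube root, so that the equation is meaningful
  without presupposing the sign of \<open>s'' + s\<close>.  A solution \<open>s\<close> is not required to be even.\<close>

definition L_minus2_Minkowski_solution :: "(real \<Rightarrow> real) \<Rightarrow> (real \<Rightarrow> real) \<Rightarrow> bool" where
  "L_minus2_Minkowski_solution \<Psi> s \<longleftrightarrow>
     smooth_on_circle s \<and> (\<forall>t. s t > 0) \<and>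
     (\<forall>t. s t * root 3 (deriv (deriv s) t + s t) = \<Psi> t)"

text \<open>The half-open interval represents each point of the circle exactly once, so the endpoints
  \<open>0\<close> and \<open>2 * pi\<close> are not counted twice.\<close>

definition critical_points :: "(real \<Rightarrow> real) \<Rightarrow> real set" where
  "critical_points f = {t \<in> {0..<2 * pi}. deriv f t = 0}"

end

theory Submission
  imports Defs
begin

text \<open>
  With \<open>f = \<Psi>\<^sup>3\<close> the equation reads \<open>f = s\<^sup>3 (s'' + s)\<close>, and with \<open>u = s\<^sup>2 / 2\<close> a computation gives
  \<open>f' / s\<^sup>2 = u''' + 4 u'\<close>.  The operator on the right is skew-adjoint on the circle and
  annihilates \<open>1\<close>, \<open>cos (2 \<theta>)\<close> and \<open>sin (2 \<theta>)\<close>, so \<open>f' / s\<^sup>2\<close> is orthogonal to these three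
  functions: an obstruction of Kazdan--Warner type.  In particular it is orthogonal to
  \<open>e \<theta> = sin (\<theta> - m) * sin (\<theta> - M)\<close> for all \<open>m\<close> and \<open>M\<close>.

  Let the \<open>pi\<close>-periodic function \<open>\<Psi>\<close>, assumed nonconstant, have its minimum at \<open>m\<close> and its maximum at
  \<open>M \<in> {m..m + pi}\<close>.  If \<open>\<Psi>\<close> is not monotone on one of the two arcs \<open>{m..M}\<close> and
  \<open>{M..m + pi}\<close>, then that arc contains two further critical points
  (\<open>two_critical_points_around_descent\<close>); together with \<open>m\<close> and \<open>M\<close> these are four in one period
  \<open>pi\<close>, and eight on the circle.  If \<open>\<Psi>\<close> is monotone on both arcs, then
  \<open>\<Psi>' * e \<le> 0\<close> everywhere, so orthogonality forces \<open>\<Psi>' * e = 0\<close>, and all points between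
  \<open>m\<close> and \<open>M\<close> are critical.

  Orthogonality is used in the form of an explicit primitive of \<open>e * f' / s\<^sup>2\<close> that is
  \<open>2 * pi\<close>-periodic (\<open>has_derivative_obstruction_primitive\<close>); a periodic function with a
  derivative of constant sign is constant.  Since \<open>\<Psi>' * e\<close> has period \<open>pi\<close>, its sign on the whole
  circle is decided on \<open>{m..m + pi}\<close>.
\<close>

section \<open>Periodic functions\<close>

lemma deriv_periodic:
  fixes f :: "real \<Rightarrow> real"
  assumes "\<And>t. f (t + c) = f t"
  shows "deriv f (t + c) = deriv f t"
  using assms by (simp add: deriv_def DERIV_shift)

lemma periodic_int_multiple:
  fixes g :: "real \<Rightarrow> 'a"
  assumes per: "\<And>t. g (t + c) = g t"
  shows "g (t + of_int k * c) = g t"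
proof -
  have nat: "g (t + real n * c) = g t" for n t
  proof (induction n)
    case (Suc n)
    have "g (t + real (Suc n) * c) = g ((t + real n * c) + c)" by (simp add: algebra_simps)
    with Suc show ?case by (simp only: per)
  qed simp
  show ?thesis
  proof (cases k)
    case (neg n)
    have "t = (t + of_int k * c) + real (Suc n) * c" unfolding neg by (simp add: algebra_simps)
    then have "g t = g ((t + of_int k * c) + real (Suc n) * c)" by (rule arg_cong)
    then show ?thesis by (simp only: nat)
  qed (simp add: nat)
qed

lemma periodic_value_attained:
  fixes g :: "real \<Rightarrow> 'a"
  assumes c: "c > 0" and per: "\<And>t. g (t + c) = g t"
  obtains t' where "t' \<in> {a..a + c}" "g t' = g t"
proof
  let ?t = "t + of_int (- \<lfloor>(t - a) / c\<rfloor>) * c"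
  have "?t = a + frac ((t - a) / c) * c" using c by (simp add: frac_def field_simps)
  then show "?t \<in> {a..a + c}" using c frac_lt_1[of "(t - a) / c"] by (auto simp: less_imp_le)
  show "g ?t = g t" by (rule periodic_int_multiple) (rule per)
qed

lemma continuous_periodic_extrema:
  fixes f :: "real \<Rightarrow> real"
  assumes cont: "continuous_on UNIV f" and c: "c > 0" and per: "\<And>t. f (t + c) = f t"
  obtains m M where "m \<le> M" "M \<le> m + c" "\<And>t. f m \<le> f t" "\<And>t. f t \<le> f M"
proof -
  have cont': "continuous_on {a..b} f" for a b by (rule continuous_on_subset[OF cont]) simp
  obtain m where m: "\<forall>t\<in>{0..0 + c}. f m \<le> f t"
    using continuous_attains_inf[OF compact_Icc _ cont', of 0 "0 + c"] c by auto
  obtain M where M: "M \<in> {m..m + c}" "\<And>t. t \<in> {m..m + c} \<Longrightarrow> f t \<le> f M"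
    using continuous_attains_sup[OF compact_Icc _ cont', of m "m + c"] c by auto
  have "f m \<le> f t" for t
    using periodic_value_attained[of c f 0 t, OF c per] m by metis
  moreover have "f t \<le> f M" for t
    using periodic_value_attained[of c f m t, OF c per] M(2) by metis
  ultimately show thesis using M(1) by (intro that[of m M]) auto
qed

text \<open>Reduction modulo the period is injective on every half-open interval of one period, so
  zeros may be counted in the fundamental interval that suits the argument best.\<close>

lemma card_zeros_le_fundamental_interval:
  fixes g :: "real \<Rightarrow> real"
  assumes c: "c > 0" and per: "\<And>t. g (t + c) = g t"
    and S: "S \<subseteq> {a..<a + c}" "\<And>t. t \<in> S \<Longrightarrow> g t = 0"
    and fin: "finite {t \<in> {0..<c}. g t = 0}"
  shows "card S \<le> card {t \<in> {0..<c}. g t = 0}"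
proof -
  define r where "r t = t - of_int \<lfloor>t / c\<rfloor> * c" for t :: real
  have r_frac: "r t = frac (t / c) * c" for t using c by (simp add: r_def frac_def field_simps)
  have "r t \<in> {t \<in> {0..<c}. g t = 0}" if "t \<in> S" for t
  proof -
    have "g (r t) = 0" using periodic_int_multiple[of g c t "- \<lfloor>t / c\<rfloor>", OF per] S(2)[OF that]
      by (simp add: r_def)
    moreover have "0 \<le> r t" "r t < c"
      using c frac_lt_1[of "t / c"] by (auto simp: r_frac)
    ultimately show ?thesis by auto
  qed
  moreover have "inj_on r S"
  proof (rule inj_onI)
    fix x y assume xy: "x \<in> S" "y \<in> S" "r x = r y"
    define k where "k = \<lfloor>x / c\<rfloor> - \<lfloor>y / c\<rfloor>"
    have k: "x - y = of_int k * c" using xy(3) by (simp add: r_def k_def algebra_simps)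
    have "\<bar>x - y\<bar> < c" using subsetD[OF S(1) xy(1)] subsetD[OF S(1) xy(2)] by auto
    then have "\<bar>of_int k :: real\<bar> * c < 1 * c" using c by (simp add: k abs_mult)
    then have "\<bar>of_int k :: real\<bar> < 1" using c mult_less_cancel_right_pos by blast
    then have "k = 0" by linarith
    with k show "x = y" by simp
  qed
  ultimately show ?thesis using fin by (intro card_inj_on_le[of r]) auto
qed

text \<open>Each critical point of an even function comes with its antipode, so four in a half circle
  are enough.\<close>

lemma eight_critical_points:
  assumes per: "\<And>t. f (t + pi) = f t"
    and ord: "a \<le> p" "p < q" "q < r" "r < v" "v < a + pi"
    and zero: "deriv f p = 0" "deriv f q = 0" "deriv f r = 0" "deriv f v = 0"
  shows "infinite (critical_points f) \<or> card (critical_points f) \<ge> 8"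
proof -
  let ?S = "{p, q, r, v, p + pi, q + pi, r + pi, v + pi}"
  have per': "deriv f (t + pi) = deriv f t" for t by (rule deriv_periodic) (rule per)
  have per2: "deriv f (t + 2 * pi) = deriv f t" for t
    using per'[of "t + pi"] per'[of t] by (simp add: add.assoc)
  have "card ?S = 8" using ord by (simp add: card_insert_if)
  moreover have "card ?S \<le> card {t \<in> {0..<2 * pi}. deriv f t = 0}"
    if "finite {t \<in> {0..<2 * pi}. deriv f t = 0}"
  proof (rule card_zeros_le_fundamental_interval[where a = a])
    show "?S \<subseteq> {a..<a + 2 * pi}" using ord by auto
  qed (use that zero in \<open>auto simp: per' per2\<close>)
  ultimately show ?thesis unfolding critical_points_def by auto
qed

section \<open>Critical points of a non-monotone arc\<close>

text \<open>Climbing from \<open>a\<close> to \<open>x\<close> requires a nonnegative derivative somewhere on the way, and the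
  intermediate value theorem for \<open>f'\<close> then gives a zero before \<open>x\<close>; similarly after \<open>x\<close>.\<close>

lemma two_critical_points_around_descent:
  fixes f f' :: "real \<Rightarrow> real"
  assumes der: "\<And>t. (f has_real_derivative f' t) (at t)" and cont: "continuous_on UNIV f'"
    and x: "a < x" "x < b" and le: "f a \<le> f x" "f x \<le> f b" and neg: "f' x < 0"
  obtains p q where "a < p" "p < x" "x < q" "q < b" "f' p = 0" "f' q = 0"
proof -
  have cont': "continuous_on {y..z} f'" for y z by (rule continuous_on_subset[OF cont]) simp
  obtain y where y: "a < y" "y < x" "f x - f a = (x - a) * f' y"
    using MVT2[OF x(1)] der by blast
  have "0 \<le> (x - a) * f' y" using le y by simp
  then have "f' y \<ge> 0" using x by (simp add: zero_le_mult_iff)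
  then obtain p where p: "y \<le> p" "p \<le> x" "f' p = 0"
    using IVT2'[OF _ _ _ cont', of x 0 y] neg y by auto
  obtain z where z: "x < z" "z < b" "f b - f x = (b - x) * f' z"
    using MVT2[OF x(2)] der by blast
  have "0 \<le> (b - x) * f' z" using le z by simp
  then have "f' z \<ge> 0" using x by (simp add: zero_le_mult_iff)
  then obtain q where q: "x \<le> q" "q \<le> z" "f' q = 0"
    using IVT'[OF _ _ _ cont', of x 0 z] neg z by auto
  from p q neg have "p \<noteq> x" "q \<noteq> x" by auto
  with p q y z show thesis by (intro that[of p q]) auto
qed

section \<open>The obstruction\<close>

text \<open>Skew-adjointness of \<open>u \<mapsto> u''' + 4 u'\<close> on the kernel element \<open>e\<close> says that
  \<open>(u''' + 4 u') e\<close> is the derivative of \<open>u'' e - u' e' + u (e'' + 4 e)\<close>.  For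
  \<open>u = s\<^sup>2 / 2\<close> and \<open>e \<theta> = sin (\<theta> - m) * sin (\<theta> - M)\<close> one has \<open>e' \<theta> = sin (2 \<theta> - m - M)\<close> and
  \<open>e'' + 4 e = 2 cos (m - M)\<close>; eliminating \<open>s''\<close> by the equation \<open>s'' + s = \<Psi>\<^sup>3 / s\<^sup>3\<close> yields the
  following primitive.\<close>

definition obstruction_primitive ::
  "(real \<Rightarrow> real) \<Rightarrow> (real \<Rightarrow> real) \<Rightarrow> real \<Rightarrow> real \<Rightarrow> real \<Rightarrow> real" where
  "obstruction_primitive \<Psi> s m M t =
     ((deriv s t)\<^sup>2 + (\<Psi> t) ^ 3 / (s t)\<^sup>2 - (s t)\<^sup>2) * (sin (t - m) * sin (t - M))
     - s t * deriv s t * sin (2 * t - m - M) + cos (m - M) * (s t)\<^sup>2"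

lemma has_derivative_obstruction_primitive:
  assumes s: "(s has_real_derivative deriv s t) (at t)"
    and s': "(deriv s has_real_derivative (\<Psi> t) ^ 3 / (s t) ^ 3 - s t) (at t)"
    and \<Psi>: "(\<Psi> has_real_derivative d) (at t)" and pos: "s t > 0"
  shows "(obstruction_primitive \<Psi> s m M has_real_derivative
           3 * (\<Psi> t)\<^sup>2 / (s t)\<^sup>2 * (d * (sin (t - m) * sin (t - M)))) (at t)"
proof -
  define x y P e S C where defs: "x = s t" "y = deriv s t" "P = \<Psi> t"
    "e = sin (t - m) * sin (t - M)" "S = sin (2 * t - m - M)" "C = cos (2 * t - m - M)"
  have x: "x > 0" using pos by (simp add: defs)
  have "((\<lambda>t. (deriv s t)\<^sup>2 + (\<Psi> t) ^ 3 / (s t)\<^sup>2 - (s t)\<^sup>2) has_real_derivative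
          2 * y * (P ^ 3 / x ^ 3 - x)
          + (3 * P\<^sup>2 * d * x\<^sup>2 - P ^ 3 * (2 * x * y)) / (x\<^sup>2 * x\<^sup>2) - 2 * x * y) (at t)"
    unfolding defs using pos by (auto intro!: derivative_eq_intros s s' \<Psi>)
  moreover have "2 * y * (P ^ 3 / x ^ 3 - x)
        + (3 * P\<^sup>2 * d * x\<^sup>2 - P ^ 3 * (2 * x * y)) / (x\<^sup>2 * x\<^sup>2) - 2 * x * y
      = 3 * P\<^sup>2 / x\<^sup>2 * d - 4 * x * y"
    using x by (simp add: field_simps power2_eq_square power3_eq_cube)
  ultimately have d1: "((\<lambda>t. (deriv s t)\<^sup>2 + (\<Psi> t) ^ 3 / (s t)\<^sup>2 - (s t)\<^sup>2) has_real_derivative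
      3 * P\<^sup>2 / x\<^sup>2 * d - 4 * x * y) (at t)" by (rule DERIV_cong)
  have d2: "((\<lambda>t. sin (t - m) * sin (t - M)) has_real_derivative S) (at t)"
    unfolding defs using sin_add[of "t - m" "t - M"]
    by (auto intro!: derivative_eq_intros simp: algebra_simps)
  have d3: "((\<lambda>t. s t * deriv s t) has_real_derivative y\<^sup>2 + P ^ 3 / x\<^sup>2 - x\<^sup>2) (at t)"
  proof (rule DERIV_cong)
    show "((\<lambda>t. s t * deriv s t) has_real_derivative y * y + (P ^ 3 / x ^ 3 - x) * x) (at t)"
      unfolding defs by (rule DERIV_mult[OF s s'])
  qed (use x in \<open>simp add: field_simps power2_eq_square power3_eq_cube\<close>)
  have d4: "((\<lambda>t. sin (2 * t - m - M)) has_real_derivative 2 * C) (at t)"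
    unfolding defs by (auto intro!: derivative_eq_intros)
  have d5: "((\<lambda>t. (s t)\<^sup>2) has_real_derivative 2 * x * y) (at t)"
    unfolding defs by (auto intro!: derivative_eq_intros s)
  have "(obstruction_primitive \<Psi> s m M has_real_derivative
      (3 * P\<^sup>2 / x\<^sup>2 * d - 4 * x * y) * e + S * (y\<^sup>2 + P ^ 3 / x\<^sup>2 - x\<^sup>2)
      - ((y\<^sup>2 + P ^ 3 / x\<^sup>2 - x\<^sup>2) * S + 2 * C * (x * y)) + cos (m - M) * (2 * x * y)) (at t)"
    using DERIV_add[OF DERIV_diff[OF DERIV_mult[OF d1 d2] DERIV_mult[OF d3 d4]]
        DERIV_cmult[OF d5, of "cos (m - M)"]]
    unfolding obstruction_primitive_def defs .
  moreover have "cos (m - M) = 2 * e + C"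
    using cos_diff[of "t - M" "t - m"] cos_add[of "t - m" "t - M"]
    by (simp add: defs algebra_simps)
  ultimately show ?thesis
    unfolding defs(1,3,4)[symmetric] by (elim DERIV_cong) (simp add: algebra_simps)
qed

lemma Minkowski_solution_curvature:
  assumes "L_minus2_Minkowski_solution \<Psi> s"
  shows "deriv (deriv s) t = (\<Psi> t) ^ 3 / (s t) ^ 3 - s t"
proof -
  have "s t > 0" and eq: "s t * root 3 (deriv (deriv s) t + s t) = \<Psi> t"
    using assms by (auto simp: L_minus2_Minkowski_solution_def)
  have "(\<Psi> t) ^ 3 = (s t) ^ 3 * (deriv (deriv s) t + s t)"
    by (simp add: eq[symmetric] power_mult_distrib odd_real_root_pow)
  with \<open>s t > 0\<close> show ?thesis by (simp add: field_simps)
qed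

lemma smooth_on_circle_derivs:
  assumes "smooth_on_circle f"
  shows "(f has_real_derivative deriv f t) (at t)"
    and "(deriv f has_real_derivative deriv (deriv f) t) (at t)"
proof -
  have "(deriv ^^ 0) f differentiable at t" "(deriv ^^ 1) f differentiable at t"
    using assms unfolding smooth_on_circle_def by blast+
  then show "(f has_real_derivative deriv f t) (at t)"
    and "(deriv f has_real_derivative deriv (deriv f) t) (at t)"
    by (auto simp: DERIV_deriv_iff_real_differentiable)
qed

text \<open>Under the sign condition the primitive is nonincreasing over a full period, yet it returns to
  its initial value; so it is constant, and its derivative vanishes.\<close>

lemma Minkowski_solution_obstruction:
  assumes \<Psi>: "smooth_on_circle \<Psi>" "\<And>t. \<Psi> t > 0" and sol: "L_minus2_Minkowski_solution \<Psi> s"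
    and sign: "\<And>t. t \<in> {m..m + 2 * pi} \<Longrightarrow> deriv \<Psi> t * (sin (t - m) * sin (t - M)) \<le> 0"
    and x: "m < x" "x < m + 2 * pi"
  shows "deriv \<Psi> x * (sin (x - m) * sin (x - M)) = 0"
proof -
  let ?F = "obstruction_primitive \<Psi> s m M"
  define F' where "F' t = 3 * (\<Psi> t)\<^sup>2 / (s t)\<^sup>2 * (deriv \<Psi> t * (sin (t - m) * sin (t - M)))" for t
  have s: "smooth_on_circle s" and s_pos: "\<And>t. s t > 0"
    using sol by (auto simp: L_minus2_Minkowski_solution_def)
  have der: "(?F has_real_derivative F' t) (at t)" for t
    unfolding F'_def
  proof (rule has_derivative_obstruction_primitive)
    show "(deriv s has_real_derivative \<Psi> t ^ 3 / s t ^ 3 - s t) (at t)"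
      using smooth_on_circle_derivs(2)[OF s, of t] by (simp add: Minkowski_solution_curvature[OF sol])
  qed (use smooth_on_circle_derivs[OF s] smooth_on_circle_derivs[OF \<Psi>(1)] s_pos in auto)
  have F'_nonpos: "F' t \<le> 0" if "t \<in> {m..m + 2 * pi}" for t
    unfolding F'_def by (rule mult_nonneg_nonpos[OF _ sign[OF that]]) simp
  have decr: "?F z \<le> ?F y" if "m \<le> y" "y \<le> z" "z \<le> m + 2 * pi" for y z
    by (rule DERIV_nonpos_imp_nonincreasing[OF that(2)]) (use der F'_nonpos that in force)
  have s_per: "s (t + 2 * pi) = s t" and \<Psi>_per: "\<Psi> (t + 2 * pi) = \<Psi> t" for t
    using s \<Psi>(1) by (auto simp: smooth_on_circle_def)
  have sin_per: "sin (m + 2 * pi - c) = sin (m - c)" "sin (2 * (m + 2 * pi) - m - c) = sin (m - c)"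
    for c
    using sin_periodic[of "m - c"] sin_periodic[of "m - c + 2 * pi"] by (auto simp: algebra_simps)
  have closed_up: "?F (m + 2 * pi) = ?F m"
    unfolding obstruction_primitive_def s_per \<Psi>_per deriv_periodic[of s "2 * pi", OF s_per] sin_per
    by simp
  have const: "?F y = ?F m" if "y \<in> {m..m + 2 * pi}" for y
    using decr[of m y] decr[of y "m + 2 * pi"] closed_up that by auto
  have "F' x = 0"
  proof (rule DERIV_local_const[OF der])
    show "0 < min (x - m) (m + 2 * pi - x)" using x by simp
    show "\<forall>y. \<bar>x - y\<bar> < min (x - m) (m + 2 * pi - x) \<longrightarrow> ?F x = ?F y"
    proof (intro allI impI)
      fix y assume "\<bar>x - y\<bar> < min (x - m) (m + 2 * pi - x)"
      then have "y \<in> {m..m + 2 * pi}" by auto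
      with const[of x] const[of y] x show "?F x = ?F y" by simp
    qed
  qed
  with \<Psi>(2)[of x] s_pos[of x] show ?thesis by (auto simp: F'_def)
qed

section \<open>The lower bound for the number of critical points\<close>

theorem corollary6p2:
  fixes \<Psi> :: "real \<Rightarrow> real"
  assumes "smooth_on_circle \<Psi>"
    and "\<And>t. \<Psi> t > 0"
    and "even_on_circle \<Psi>"
    and "\<exists>s. L_minus2_Minkowski_solution \<Psi> s"
  shows "infinite (critical_points \<Psi>) \<or> card (critical_points \<Psi>) \<ge> 8"
proof (rule ccontr)
  assume few: "\<not> ?thesis"
  have per: "\<Psi> (t + pi) = \<Psi> t" for t using assms(3) by (simp add: even_on_circle_def)
  have per': "deriv \<Psi> (t + pi) = deriv \<Psi> t" for t by (rule deriv_periodic) (rule per)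
  note der = smooth_on_circle_derivs[OF assms(1)]
  have cont: "continuous_on UNIV \<Psi>" "continuous_on UNIV (deriv \<Psi>)"
    by (auto intro!: continuous_at_imp_continuous_on DERIV_isCont der)
  have no_four: False
    if "a \<le> p" "p < q" "q < r" "r < v" "v < a + pi"
      "deriv \<Psi> p = 0" "deriv \<Psi> q = 0" "deriv \<Psi> r = 0" "deriv \<Psi> v = 0" for a p q r v
    using eight_critical_points[of \<Psi> a p q r v, OF per that] few by blast
  have no_flat_arc: False if "a < b" "b < a + pi" "\<And>t. a < t \<Longrightarrow> t < b \<Longrightarrow> deriv \<Psi> t = 0" for a b
  proof -
    define h where "h = (b - a) / 5"
    have "h > 0" "b = a + 5 * h" using that(1) by (auto simp: h_def field_simps)
    with that show False
      by (intro no_four[of a "a + h" "a + 2 * h" "a + 3 * h" "a + 4 * h"]) auto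
  qed
  obtain m M where mM: "m \<le> M" "M \<le> m + pi" and extr: "\<And>t. \<Psi> m \<le> \<Psi> t" "\<And>t. \<Psi> t \<le> \<Psi> M"
    using continuous_periodic_extrema[of \<Psi> pi, OF cont(1) pi_gt_zero per] by metis
  \<comment> \<open>Both extrema are global, so the local criteria apply with any radius.\<close>
  have crit: "deriv \<Psi> m = 0" "deriv \<Psi> M = 0"
    using DERIV_local_min[OF der(1) zero_less_one] DERIV_local_max[OF der(1) zero_less_one] extr
    by blast+
  have "\<Psi> m \<noteq> \<Psi> M"
  proof
    assume "\<Psi> m = \<Psi> M"
    with extr have "\<Psi> t = \<Psi> m" for t by (metis order_antisym)
    then have "\<Psi> = (\<lambda>t. \<Psi> m)" by (simp add: fun_eq_iff)
    then have "deriv \<Psi> t = 0" for t by (metis deriv_const)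
    then show False using no_flat_arc[of 0 1] pi_gt3 by simp
  qed
  then have strict: "m < M" "M < m + pi" using mM per[of m] by (auto simp: less_le)
  have up: "deriv \<Psi> t \<ge> 0" if t: "m < t" "t < M" for t
  proof (rule ccontr)
    assume "\<not> deriv \<Psi> t \<ge> 0"
    then have "deriv \<Psi> t < 0" by simp
    then obtain p q where "m < p" "p < t" "t < q" "q < M" "deriv \<Psi> p = 0" "deriv \<Psi> q = 0"
      using two_critical_points_around_descent[OF der(1) cont(2) t extr] by metis
    then show False using no_four[of m m p q M] crit strict by simp
  qed
  have down: "deriv \<Psi> t \<le> 0" if t: "M < t" "t < m + pi" for t
  proof (rule ccontr)
    assume "\<not> deriv \<Psi> t \<le> 0"
    then have neg: "- deriv \<Psi> t < 0" by simp
    have der_uminus: "((\<lambda>t. - \<Psi> t) has_real_derivative - deriv \<Psi> t) (at t)" for t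
      by (rule DERIV_minus) (rule der(1))
    have cont_uminus: "continuous_on UNIV (\<lambda>t. - deriv \<Psi> t)" by (intro continuous_intros cont)
    have le: "- \<Psi> M \<le> - \<Psi> t" "- \<Psi> t \<le> - \<Psi> (m + pi)" using extr per[of m] by auto
    obtain p q where
      "M < p" "p < t" "t < q" "q < m + pi" "deriv \<Psi> p = 0" "deriv \<Psi> q = 0"
      using two_critical_points_around_descent[OF der_uminus cont_uminus t le neg]
      by (metis neg_equal_0_iff_equal)
    then show False using no_four[of m m M p q] crit strict by simp
  qed
  \<comment> \<open>The product of sines changes sign exactly at the two extrema modulo \<open>pi\<close>.\<close>
  let ?e = "\<lambda>t. sin (t - m) * sin (t - M)"
  have sign_half: "deriv \<Psi> t * ?e t \<le> 0" if "m \<le> t" "t \<le> m + pi" for t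
  proof -
    consider "t = m" | "t = M" | "t = m + pi" | "m < t" "t < M" | "M < t" "t < m + pi"
      using \<open>m \<le> t\<close> \<open>t \<le> m + pi\<close> by linarith
    then show ?thesis
    proof cases
      case 4
      have "sin (M - t) \<ge> 0" using 4 strict by (intro sin_ge_zero) auto
      moreover have "sin (t - m) \<ge> 0" using 4 strict by (intro sin_ge_zero) auto
      moreover have "sin (t - M) = - sin (M - t)" using sin_minus[of "M - t"] by simp
      ultimately show ?thesis using up[OF 4] by (simp add: mult_nonneg_nonneg)
    next
      case 5
      have "sin (t - M) \<ge> 0" "sin (t - m) \<ge> 0" using 5 strict by (auto intro!: sin_ge_zero)
      then show ?thesis using down[OF 5] by (intro mult_nonpos_nonneg) auto
    qed auto
  qed
  have sign: "deriv \<Psi> t * ?e t \<le> 0" if "t \<in> {m..m + 2 * pi}" for t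
  proof (cases "t \<le> m + pi")
    case True
    with that sign_half show ?thesis by simp
  next
    case False
    have "sin (t - pi - c) = - sin (t - c)" for c
      using sin_periodic_pi[of "t - pi - c"] by simp
    then have "?e (t - pi) = ?e t" by simp
    moreover have "deriv \<Psi> (t - pi) = deriv \<Psi> t" using per'[of "t - pi"] by simp
    moreover have "deriv \<Psi> (t - pi) * ?e (t - pi) \<le> 0" using False that by (intro sign_half) auto
    ultimately show ?thesis by simp
  qed
  obtain s where sol: "L_minus2_Minkowski_solution \<Psi> s" using assms(4) by blast
  have "deriv \<Psi> t = 0" if "m < t" "t < M" for t
  proof -
    have "sin (t - m) > 0" "sin (M - t) > 0" using that strict by (auto intro!: sin_gt_zero)
    moreover have "sin (t - M) = - sin (M - t)" using sin_minus[of "M - t"] by simp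
    moreover have "deriv \<Psi> t * ?e t = 0"
      using Minkowski_solution_obstruction[OF assms(1,2) sol sign] that strict by simp
    ultimately show ?thesis by simp
  qed
  then show False using no_flat_arc[of m M] strict by simp
qed

end
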